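(* For every $n\in\mathbb{N}$, $F(n,x)=\dfrac{P_n(-x)}{P_{n+1}(x)}$. Consequently, for every positive integer $n$, $F(n,x)=\dfrac{1}{-x+F(n-1,-x)}$.
   Context: For $n\in\mathbb{N}$, $P_n(x)=\sum_{k=0}^{n}(-1)^{\lfloor 3k/2\rfloor}\binom{\lfloor (n+k)/2\rfloor}{k}x^k$ (so $P_0=1$). For a positive integer $m$, $A_m$ is the $m\times m$ matrix with $(i,j)$ entry $1$ if $i+j\le m+1$ and $0$ otherwise, and $u_m=(1,\dots,1)^T\in\mathbb{R}^m$. For $n\in\mathbb{N}$, $F(n,x)=1+\sum_{k\ge 0}\left(u_{n+1}^TA_{n+1}^k u_{n+1}\right)x^{k+1}$, a formal power series in $x$. *)

theory Defs
  imports
    "HOL-Computational_Algebra.Polynomial_FPS"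
    "Jordan_Normal_Form.Matrix"
begin

definition P_poly :: "nat \<Rightarrow> real poly" where
  "P_poly n = (\<Sum>k\<le>n. monom ((-1) ^ (3 * k div 2) * of_nat (((n + k) div 2) choose k)) k)"

text \<open>Matrix indices start at 0 in the library, hence the shift by \<open>Suc\<close>.\<close>

definition A_mat :: "nat \<Rightarrow> real mat" where
  "A_mat m = mat m m (\<lambda>(i, j). if Suc i + Suc j \<le> m + 1 then 1 else 0)"

definition u_vec :: "nat \<Rightarrow> real vec" where
  "u_vec m = vec m (\<lambda>_. 1)"

definition F_fps :: "nat \<Rightarrow> real fps" where
  "F_fps n = 1 + fps_X * Abs_fps (\<lambda>k.
     u_vec (n + 1) \<bullet> ((A_mat (n + 1) ^\<^sub>m k) *\<^sub>v u_vec (n + 1)))"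

text \<open>The substitution \<open>f(x) \<mapsto> f(-x)\<close>.\<close>

definition fps_neg_arg :: "real fps \<Rightarrow> real fps" where
  "fps_neg_arg f = fps_compose f (- fps_X)"

text \<open>The library's division of power series over a field is total; it is the usual quotient when
  the constant term of the divisor is nonzero, in particular for a divisor of the form
  \<open>fps_of_poly (P_poly n)\<close> or \<open>- fps_X + fps_neg_arg (F_fps n)\<close>.\<close>

lemma fps_nth_P_poly_0: "fps_nth (fps_of_poly (P_poly n)) 0 = 1"
proof -
  have "coeff (P_poly n) 0 = (\<Sum>k\<le>n. if k = 0 then 1 else 0)"
    unfolding P_poly_def coeff_sum by (intro sum.cong) auto
  then show ?thesis by simp
qed

lemma fps_nth_denominator_0: "fps_nth (- fps_X + fps_neg_arg (F_fps n)) 0 = 1"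
  by (simp add: F_fps_def fps_neg_arg_def)

end

theory Submission imports Defs begin

text \<open>Let \<open>m = n + 1\<close>. The vector \<open>v = (I - xA)\<^sup>-\<^sup>1 u\<close> over the power series satisfies
  \<open>v\<^sub>i = 1 + x (v\<^sub>0 + \<dots> + v\<^bsub>m-1-i\<^esub>)\<close>, so \<open>v\<^sub>0 = F(n, x)\<close>. Taking differences, this system says
  \<open>v\<^sub>i - v\<^bsub>i+1\<^esub> = x v\<^bsub>m-1-i\<^esub>\<close> with \<open>v\<^sub>m = 1\<close>. By the recurrence
  \<open>P\<^bsub>k+2\<^esub>(x) = P\<^sub>k(x) - x P\<^bsub>k+1\<^esub>(-x)\<close>, which is Pascal's rule, the sequence with entries
  \<open>P\<^bsub>m-1-2i\<^esub>(-x)\<close> for \<open>2i < m\<close> and \<open>P\<^bsub>2i-m\<^esub>(x)\<close> for \<open>2i \<ge> m\<close> satisfies the same difference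
  equations and ends in \<open>P\<^sub>m(x)\<close>. By uniqueness it equals \<open>P\<^sub>m(x) v\<close>; compare the entries at \<open>0\<close>.
  The second identity is the first one combined with the recurrence.\<close>

lemma fps_nth_neg_arg: "fps_nth (fps_neg_arg f) k = (-1) ^ k * fps_nth f k"
  by (simp add: fps_neg_arg_def fps_compose_uminus')

lemma coeff_P_poly:
  "coeff (P_poly n) k = (-1) ^ (3 * k div 2) * real (((n + k) div 2) choose k)"
proof -
  have "coeff (P_poly n) k =
      (\<Sum>j\<le>n. if j = k then (-1) ^ (3 * k div 2) * real (((n + k) div 2) choose k) else 0)"
    unfolding P_poly_def coeff_sum coeff_monom by (intro sum.cong) auto
  \<comment> \<open>For \<open>k > n\<close> the upper index \<open>(n + k) div 2\<close> is below
    \<open>k\<close>, so the binomial vanishes and the formula holds for every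
    \<open>k\<close>.\<close>
  also have "\<dots> = (-1) ^ (3 * k div 2) * real (((n + k) div 2) choose k)"
    by (auto simp: binomial_eq_0)
  finally show ?thesis .
qed

definition P_fps :: "nat \<Rightarrow> real fps" where
  "P_fps n = fps_of_poly (P_poly n)"

lemma P_fps_nth: "fps_nth (P_fps n) k = (-1) ^ (3 * k div 2) * real (((n + k) div 2) choose k)"
  by (simp add: P_fps_def coeff_P_poly)

lemma P_fps_0: "P_fps 0 = 1"
  by (rule fps_ext) (auto simp: P_fps_nth binomial_eq_0)

lemma P_fps_1: "P_fps (Suc 0) = 1 - fps_X"
proof (rule fps_ext)
  fix k :: nat
  consider "k = 0" | "k = 1" | "k > 1" by linarith
  then show "fps_nth (P_fps (Suc 0)) k = fps_nth (1 - fps_X) k"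
    by cases (auto simp: P_fps_nth binomial_eq_0)
qed

lemma P_fps_rec: "P_fps (Suc (Suc n)) = P_fps n - fps_X * fps_neg_arg (P_fps (Suc n))"
proof (rule fps_ext)
  fix k
  show "fps_nth (P_fps (Suc (Suc n))) k = fps_nth (P_fps n - fps_X * fps_neg_arg (P_fps (Suc n))) k"
  proof (cases k)
    case 0
    then show ?thesis by (simp add: P_fps_nth)
  next
    case (Suc j)
    \<comment> \<open>The exponent grows by 1 for even \<open>j\<close> and by 2 for odd
      \<open>j\<close>; the factor \<open>(-1) ^ j\<close> is the one that
      \<open>fps_neg_arg\<close> contributes.\<close>
    have "(-1) ^ (3 * Suc j div 2) = - ((-1 :: real) ^ j * (-1) ^ (3 * j div 2))"
    proof (cases "even j")
      case True
      then obtain i where "j = 2 * i" by blast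
      then have "3 * Suc j div 2 = 3 * i + 1" "3 * j div 2 = 3 * i" by auto
      with True show ?thesis by simp
    next
      case False
      then obtain i where "j = 2 * i + 1" by (rule oddE)
      then have "3 * Suc j div 2 = 3 * i + 3" "3 * j div 2 = 3 * i + 1" by auto
      with False show ?thesis by (simp add: power_add)
    qed
    \<comment> \<open>All three binomials now have upper index \<open>(Suc n + j) div 2\<close> or
      its successor, as Pascal's rule requires.\<close>
    moreover have "(Suc (Suc n) + Suc j) div 2 = Suc ((Suc n + j) div 2)"
      "(n + Suc j) div 2 = (Suc n + j) div 2" by auto
    ultimately show ?thesis
      by (simp add: Suc P_fps_nth fps_nth_neg_arg algebra_simps)
  qed
qed

lemma fps_neg_arg_0_nth [simp]: "fps_nth (fps_neg_arg f) 0 = fps_nth f 0"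
  by (simp add: fps_nth_neg_arg)

lemma fps_neg_arg_neg_arg: "fps_neg_arg (fps_neg_arg f) = f"
  by (rule fps_ext) (simp add: fps_nth_neg_arg flip: mult.assoc power_mult_distrib)

lemma fps_neg_arg_diff: "fps_neg_arg (f - g) = fps_neg_arg f - fps_neg_arg g"
  by (simp add: fps_neg_arg_def fps_compose_sub_distrib)

lemma fps_neg_arg_mult: "fps_neg_arg (f * g) = fps_neg_arg f * fps_neg_arg g"
  by (simp add: fps_neg_arg_def fps_compose_mult_distrib)

lemma fps_neg_arg_1: "fps_neg_arg 1 = 1"
  by (simp add: fps_neg_arg_def)

lemma fps_neg_arg_X: "fps_neg_arg fps_X = - fps_X"
  by (simp add: fps_neg_arg_def)

lemma neg_arg_P_fps_rec:
  "fps_neg_arg (P_fps (Suc (Suc n))) = fps_neg_arg (P_fps n) + fps_X * P_fps (Suc n)"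
  by (simp add: P_fps_rec[of n] fps_neg_arg_diff fps_neg_arg_mult fps_neg_arg_X
      fps_neg_arg_neg_arg)

definition P_chain :: "nat \<Rightarrow> nat \<Rightarrow> real fps" where
  "P_chain m i =
    (if 2 * i < m then fps_neg_arg (P_fps (m - 1 - 2 * i)) else P_fps (2 * i - m))"

text \<open>Left of the middle this is the recurrence at -x, right of it the recurrence at x. Where
  the chain changes branch, one case per parity of \<open>m\<close>, it is checked on
  \<open>P_fps 0\<close> and \<open>P_fps 1\<close>.\<close>

lemma P_chain_step:
  assumes "i < m"
  shows "P_chain m i = P_chain m (Suc i) + fps_X * P_chain m (m - Suc i)"
proof -
  consider "2 * i + 2 < m" | "2 * i + 2 = m" | "2 * i + 1 = m" | "m \<le> 2 * i" by linarith
  then show ?thesis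
  proof cases
    case 1
    define r where "r = m - 3 - 2 * i"
    with 1 have "m = r + 2 * i + 3" by simp
    then show ?thesis using neg_arg_P_fps_rec[of r] by (simp add: P_chain_def)
  next
    case 2
    then show ?thesis
      by (auto simp: P_chain_def P_fps_0 P_fps_1 fps_neg_arg_diff fps_neg_arg_1 fps_neg_arg_X)
  next
    case 3
    then show ?thesis
      by (auto simp: P_chain_def P_fps_0 P_fps_1 fps_neg_arg_1)
  next
    case 4
    define r where "r = 2 * i - m"
    define s where "s = m - i - 1"
    from 4 assms have "i = r + s + 1" "m = r + 2 * s + 2" unfolding r_def s_def by auto
    then show ?thesis using P_fps_rec[of r] by (simp add: P_chain_def)
  qed
qed

text \<open>The differences telescope downwards from \<open>i = m\<close>, where the sum is empty;
  each step adds the summand \<open>j = m - Suc i\<close>.\<close>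

lemma P_chain_eq_sum:
  assumes "i \<le> m"
  shows "P_chain m i = P_fps m + fps_X * (\<Sum>j<m - i. P_chain m j)"
  using assms
proof (induction i rule: inc_induct)
  case base
  show ?case by (cases "m = 0") (auto simp: P_chain_def)
next
  case (step i)
  then have "m - i = Suc (m - Suc i)" by simp
  then show ?case
    using step.IH P_chain_step[OF step.hyps(2)] by (simp add: algebra_simps)
qed

definition resolvent_fps :: "nat \<Rightarrow> nat \<Rightarrow> real fps" where
  "resolvent_fps m i = Abs_fps (\<lambda>k. ((A_mat m ^\<^sub>m k) *\<^sub>v u_vec m) $ i)"

lemma A_mat_carrier [simp]: "A_mat m \<in> carrier_mat m m"
  by (simp add: A_mat_def)

lemma u_vec_carrier [simp]: "u_vec m \<in> carrier_vec m"
  by (simp add: u_vec_def)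

lemma A_mat_pow_carrier [simp]: "A_mat m ^\<^sub>m k \<in> carrier_mat m m"
  by (intro pow_carrier_mat A_mat_carrier)

lemma A_mat_mult_vec:
  assumes "v \<in> carrier_vec m" "i < m"
  shows "(A_mat m *\<^sub>v v) $ i = (\<Sum>j<m - i. v $ j)"
proof -
  have "(A_mat m *\<^sub>v v) $ i = (\<Sum>j\<in>{0..<m}. if j < m - i then v $ j else 0)"
    using assms by (auto simp: A_mat_def scalar_prod_def intro!: sum.cong)
  also have "\<dots> = (\<Sum>j<m - i. v $ j)"
    by (intro sum.mono_neutral_cong_right) auto
  finally show ?thesis .
qed

text \<open>\<open>pow_mat\<close> appends the new factor on the right; it is moved to the left so
  that \<open>A_mat_mult_vec\<close> can act on the previous vector.\<close>

lemma A_mat_pow_Suc_vec: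
  "(A_mat m ^\<^sub>m Suc k) *\<^sub>v u_vec m = A_mat m *\<^sub>v ((A_mat m ^\<^sub>m k) *\<^sub>v u_vec m)"
proof -
  have "A_mat m ^\<^sub>m Suc k = A_mat m * A_mat m ^\<^sub>m k"
  proof (induction k)
    case (Suc k)
    have "A_mat m ^\<^sub>m Suc (Suc k) = A_mat m ^\<^sub>m Suc k * A_mat m"
      by simp
    also have "\<dots> = A_mat m * A_mat m ^\<^sub>m k * A_mat m"
      by (simp only: Suc.IH)
    also have "\<dots> = A_mat m * A_mat m ^\<^sub>m Suc k"
      by (simp add: assoc_mult_mat[OF A_mat_carrier A_mat_pow_carrier A_mat_carrier])
    finally show ?case .
  qed (simp add: A_mat_def)
  then show ?thesis
    by (simp add: assoc_mult_mat_vec[OF A_mat_carrier A_mat_pow_carrier u_vec_carrier])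
qed

lemma resolvent_fps_eq:
  assumes "i < m"
  shows "resolvent_fps m i = 1 + fps_X * (\<Sum>j<m - i. resolvent_fps m j)"
proof (rule fps_ext)
  fix k
  show "fps_nth (resolvent_fps m i) k = fps_nth (1 + fps_X * (\<Sum>j<m - i. resolvent_fps m j)) k"
  proof (cases k)
    case 0
    with assms show ?thesis by (simp add: resolvent_fps_def u_vec_def A_mat_def)
  next
    case (Suc l)
    have "(A_mat m ^\<^sub>m l) *\<^sub>v u_vec m \<in> carrier_vec m"
      by (rule mult_mat_vec_carrier[OF A_mat_pow_carrier u_vec_carrier])
    with assms Suc show ?thesis
      by (simp add: resolvent_fps_def A_mat_pow_Suc_vec A_mat_mult_vec fps_sum_nth
          del: pow_mat.simps)
  qed
qed

text \<open>Row 0 of the matrix consists of ones, so the equation for entry 0 sums the whole vector,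
  just as the product with \<open>u_vec\<close> does.\<close>

lemma F_fps_eq_resolvent: "F_fps n = resolvent_fps (Suc n) 0"
proof -
  have "u_vec m \<bullet> v = (\<Sum>j<m. v $ j)" if "v \<in> carrier_vec m" for m v
    using that by (auto simp: u_vec_def scalar_prod_def lessThan_atLeast0)
  moreover have "(A_mat m ^\<^sub>m k) *\<^sub>v u_vec m \<in> carrier_vec m" for m k
    by (rule mult_mat_vec_carrier[OF A_mat_pow_carrier u_vec_carrier])
  ultimately have "Abs_fps (\<lambda>k. u_vec (n + 1) \<bullet> ((A_mat (n + 1) ^\<^sub>m k) *\<^sub>v u_vec (n + 1)))
      = (\<Sum>j<Suc n. resolvent_fps (Suc n) j)"
    by (intro fps_ext) (simp add: resolvent_fps_def fps_sum_nth)
  then show ?thesis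
    using resolvent_fps_eq[of 0 "Suc n"] by (simp add: F_fps_def)
qed

text \<open>This is the uniqueness: the factor \<open>fps_X\<close> expresses coefficient
  \<open>Suc k\<close> of each entry by coefficients \<open>k\<close> of all entries, hence one
  induction on \<open>k\<close> for all \<open>i\<close> at once.\<close>

lemma fps_X_system_zero:
  fixes d :: "nat \<Rightarrow> 'a :: comm_ring_1 fps"
  assumes "\<And>i. i < m \<Longrightarrow> d i = fps_X * (\<Sum>j<m - i. d j)" and "i < m"
  shows "d i = 0"
proof (rule fps_ext)
  fix k
  show "fps_nth (d i) k = fps_nth 0 k"
    using assms(2)
  proof (induction k arbitrary: i)
    case 0
    have "fps_nth (d i) 0 = fps_nth (fps_X * (\<Sum>j<m - i. d j)) 0" using assms(1)[OF 0] by simp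
    then show ?case by simp
  next
    case (Suc k)
    have "fps_nth (d i) (Suc k) = fps_nth (fps_X * (\<Sum>j<m - i. d j)) (Suc k)"
      using assms(1)[OF Suc.prems] by simp
    then show ?case using Suc.IH by (simp add: fps_sum_nth)
  qed
qed

lemma F_fps_mult_P_fps: "P_fps (Suc n) * F_fps n = fps_neg_arg (P_fps n)"
proof -
  define m where "m = Suc n"
  \<comment> \<open>Both terms solve the system with inhomogeneous part \<open>P_fps m\<close>,
    which cancels in the difference.\<close>
  define d where "d i = P_chain m i - P_fps m * resolvent_fps m i" for i
  have "d i = fps_X * (\<Sum>j<m - i. d j)" if "i < m" for i
    using that P_chain_eq_sum[of i m] resolvent_fps_eq[of i m]
    by (simp add: d_def sum_subtractf algebra_simps flip: sum_distrib_left)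
  then have "d 0 = 0"
    by (rule fps_X_system_zero) (simp_all add: m_def)
  then show ?thesis
    by (simp add: d_def m_def P_chain_def F_fps_eq_resolvent)
qed

lemma P_fps_nth_0: "fps_nth (P_fps n) 0 = 1"
  unfolding P_fps_def by (rule fps_nth_P_poly_0)

theorem theorem4p18:
  shows "(\<forall>n::nat. F_fps n = fps_neg_arg (fps_of_poly (P_poly n)) / fps_of_poly (P_poly (n + 1))) \<and>
    (\<forall>n::nat. n > 0 \<longrightarrow> F_fps n = 1 / (- fps_X + fps_neg_arg (F_fps (n - 1))))"
proof (intro conjI allI impI)
  fix n :: nat
  have "P_fps (Suc n) \<noteq> 0"
    using P_fps_nth_0[of "Suc n"] by auto
  then have "F_fps n = fps_neg_arg (P_fps n) / P_fps (Suc n)"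
    by (simp flip: F_fps_mult_P_fps)
  then show "F_fps n = fps_neg_arg (fps_of_poly (P_poly n)) / fps_of_poly (P_poly (n + 1))"
    by (simp add: P_fps_def)
next
  fix n :: nat
  assume "n > 0"
  then obtain l where n: "n = Suc l" by (cases n) auto
  let ?D = "- fps_X + fps_neg_arg (F_fps l)" and ?Q = "fps_neg_arg (P_fps n)"
  \<comment> \<open>The first identity for \<open>l\<close> with x replaced by -x; the recurrence
    then turns \<open>?Q * ?D\<close> into \<open>P_fps (Suc n)\<close>.\<close>
  have "?Q * fps_neg_arg (F_fps l) = P_fps l"
    using arg_cong[OF F_fps_mult_P_fps[of l], of fps_neg_arg]
    by (simp add: n fps_neg_arg_mult fps_neg_arg_neg_arg)
  then have "?Q * ?D = P_fps (Suc n)"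
    by (simp add: n P_fps_rec algebra_simps)
  then have "?Q * (?D * F_fps n) = ?Q"
    using F_fps_mult_P_fps[of n] by (simp flip: mult.assoc)
  moreover have "?Q \<noteq> 0"
    using P_fps_nth_0[of n] by (metis fps_neg_arg_0_nth fps_zero_nth zero_neq_one)
  ultimately have one: "?D * F_fps n = 1" by simp
  then have "?D \<noteq> 0" by auto
  then have "F_fps n = 1 / ?D"
    by (metis one nonzero_mult_div_cancel_left)
  then show "F_fps n = 1 / (- fps_X + fps_neg_arg (F_fps (n - 1)))"
    by (simp add: n)
qed

end
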